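(* Let $s,t$ be arbitrary (complex, or indeterminate) parameters. For all integers $n\ge0$ and $0\le k\le n$, the $(s,t)$-Eulerian numbers $E_{(s,t)}(n,k)$ satisfy $$E_{(s,t)}(n,k)=\frac{1}{k!}\sum_{j=0}^k(-1)^{k-j}\binom{k}{j}\,(n+s+t)^{\underline{k-j}}\;(s+t)^{\overline{j}}\,(s+j)^n .$$
   Context: The $(s,t)$-Eulerian numbers (the case $\nu=1$ of the $\nu$-order $(s,t)$-Eulerian numbers) are defined by $$E_{(s,t)}(n,k)=(k+s)\,E_{(s,t)}(n-1,k)+(n-k+t)\,E_{(s,t)}(n-1,k-1)+\delta_{k0}\delta_{n0},$$ with $E_{(s,t)}(n,k)=0$ if $n<0$ or $k<0$. They are polynomials in $s,t$, and $s,t$ are treated as indeterminate parameters. Notation: $x^{\overline{j}}=x(x+1)\cdots(x+j-1)$ and $x^{\underline{j}}=x(x-1)\cdots(x-j+1)$ are the raising and falling factorials (equal to $1$ for $j=0$). Convention: $0^0=1$. *)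

theory Defs
  imports Complex_Main
begin

text \<open>The \<open>(s,t)\<close>-Eulerian numbers, given by their recurrence on integer indices; the last summand is
  \<open>\<delta>\<^sub>k\<^sub>0 \<delta>\<^sub>n\<^sub>0\<close>, which supplies the initial value since the recursive terms vanish at \<open>n = 0\<close>.\<close>

function st_eulerian :: "'a::comm_ring_1 \<Rightarrow> 'a \<Rightarrow> int \<Rightarrow> int \<Rightarrow> 'a" where
  "st_eulerian s t n k =
     (if n < 0 \<or> k < 0 then 0
      else (of_int k + s) * st_eulerian s t (n - 1) k
         + (of_int n - of_int k + t) * st_eulerian s t (n - 1) (k - 1)
         + (if k = 0 \<and> n = 0 then 1 else 0))"
  by pat_completeness auto
termination
  by (relation "measure (\<lambda>(s, t, n, k). nat (n + 1))") auto

declare st_eulerian.simps [simp del]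

text \<open>The rising factorial is \<^const>\<open>pochhammer\<close>.\<close>

definition falling_factorial :: "'a::comm_ring_1 \<Rightarrow> nat \<Rightarrow> 'a" where
  "falling_factorial x j = (\<Prod>i<j. x - of_nat i)"

end

theory Submission
  imports Defs "HOL-Computational_Algebra.Formal_Power_Series"
begin

text \<open>
  Put \<open>x = s + t\<close>. Since \<open>\<Sum>\<^sub>j pochhammer x j z\<^sup>j / j! = (1 - z)\<^bsup>-x\<^esup>\<close>, the right-hand side of the
  theorem is the coefficient of \<open>z\<^sup>k\<close> in
  \<open>A\<^sub>n(z) = (1 - z)\<^bsup>n+x\<^esup> (s + z d/dz)\<^sup>n (1 - z)\<^bsup>-x\<^esup>\<close>.
  Clearly \<open>A\<^sub>0 = 1\<close>, which gives the initial values, and commuting \<open>s + z d/dz\<close> with the power of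
  \<open>1 - z\<close> gives
  \<open>A\<^bsub>n+1\<^esub> = (1 - z) (s + z d/dz) A\<^sub>n + (n + x) z A\<^sub>n\<close>,
  which on coefficients is the defining recurrence of the \<open>(s,t)\<close>-Eulerian numbers.

  The proof carries this out on coefficients: \<open>eulerian_sum x s n k\<close> is the coefficient of \<open>z\<^sup>k\<close>.
  Its value at \<open>n = 0\<close> is Vandermonde's convolution
  for \<open>(1 - z)\<^sup>x (1 - z)\<^bsup>-x\<^esup> = 1\<close> (\<open>eulerian_sum_0\<close>). The recurrence (\<open>eulerian_sum_Suc_Suc\<close>) holds
  separately for each power \<open>(s + j)\<^sup>n\<close>, where it combines Pascal's rule for multiplication by
  \<open>1 - z\<close> with the absorption identity for differentiation (\<open>gbinomial_eulerian_step\<close>).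
\<close>

definition eulerian_sum :: "'a::field_char_0 \<Rightarrow> 'a \<Rightarrow> nat \<Rightarrow> nat \<Rightarrow> 'a" where
  "eulerian_sum x s n k =
     (\<Sum>j\<le>k. (- 1) ^ (k - j) * ((of_nat n + x) gchoose (k - j))
        * (pochhammer x j / fact j * (s + of_nat j) ^ n))"

lemma falling_factorial_eq_gbinomial:
  "falling_factorial (a :: 'a::field_char_0) m = fact m * (a gchoose m)"
  by (simp add: falling_factorial_def gbinomial_prod_rev lessThan_atLeast0)

lemma eulerian_sum_0: "eulerian_sum x s 0 k = (if k = 0 then 1 else 0)"
proof -
  have "eulerian_sum x s 0 k = (\<Sum>j\<le>k. (- 1) ^ k * ((- x gchoose j) * (x gchoose (k - j))))"
    unfolding eulerian_sum_def
  proof (rule sum.cong [OF refl])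
    fix j assume "j \<in> {..k}"
    hence "(- 1 :: 'a) ^ k = (- 1) ^ (k - j) * (- 1) ^ j"
      by (simp flip: power_add)
    moreover have "pochhammer x j / fact j = (- 1) ^ j * (- x gchoose j)"
      by (simp add: gbinomial_pochhammer)
    ultimately show "(- 1) ^ (k - j) * ((of_nat 0 + x) gchoose (k - j))
        * (pochhammer x j / fact j * (s + of_nat j) ^ 0)
      = (- 1) ^ k * ((- x gchoose j) * (x gchoose (k - j)))"
      by simp
  qed
  also have "\<dots> = (- 1) ^ k * ((- x + x) gchoose k)"
    by (simp add: gbinomial_Vandermonde atMost_atLeast0 flip: sum_distrib_left)
  finally show ?thesis
    by (cases k) simp_all
qed

lemma eulerian_sum_Suc_0: "eulerian_sum x s (Suc n) 0 = s * eulerian_sum x s n 0"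
  by (simp add: eulerian_sum_def)

text \<open>
  With \<open>b\<^sub>m = (- 1)\<^sup>m (N gchoose m)\<close>, the coefficients of \<open>(1 - z)\<^sup>N\<close>, the coefficients of
  \<open>(1 - z)\<^bsup>N+1\<^esup>\<close> are \<open>b\<^bsub>m+1\<^esub> - b\<^sub>m\<close>. The part of the claim not multiplied by \<open>a\<close> is then absorption,
  \<open>(m + 1) b\<^bsub>m+1\<^esub> = - (N - m) b\<^sub>m\<close>, that is, \<open>(1 - z) d/dz (1 - z)\<^sup>N = - N (1 - z)\<^sup>N\<close>.
\<close>

lemma gbinomial_eulerian_step:
  fixes N a :: "'a::field_char_0"
  shows "(- 1) ^ Suc m * ((N + 1) gchoose Suc m) * a
    = (of_nat (Suc m) + a) * ((- 1) ^ Suc m * (N gchoose Suc m))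
      + (N - of_nat m - a) * ((- 1) ^ m * (N gchoose m))"
proof -
  have pascal: "(N + 1) gchoose Suc m = (N gchoose m) + (N gchoose Suc m)"
    by (rule gbinomial_Suc_Suc)
  have absorption: "of_nat (Suc m) * (N gchoose Suc m) = (N - of_nat m) * (N gchoose m)"
    using gbinomial_mult_1 [of N m] by (simp add: algebra_simps)
  have "(of_nat (Suc m) + a) * ((- 1) ^ Suc m * (N gchoose Suc m))
      + (N - of_nat m - a) * ((- 1) ^ m * (N gchoose m))
    = (- 1) ^ m * ((N - of_nat m) * (N gchoose m) - of_nat (Suc m) * (N gchoose Suc m))
      + (- 1) ^ Suc m * ((N gchoose m) + (N gchoose Suc m)) * a"
    by (simp only: power_Suc) algebra
  thus ?thesis
    by (simp only: pascal absorption diff_self mult_zero_right add_0_left)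
qed

text \<open>
  The recurrence holds for each \<open>j\<close> separately: the factor \<open>s + j\<close> that the \<open>j\<close>-th summand
  gains in passing from \<open>n\<close> to \<open>n + 1\<close> is the \<open>a\<close> of the previous lemma. The summand \<open>j = k + 1\<close>
  occurs only in the first two of the three sums.
\<close>

lemma eulerian_sum_Suc_Suc:
  "eulerian_sum x s (Suc n) (Suc k)
    = (of_nat (Suc k) + s) * eulerian_sum x s n (Suc k)
      + (of_nat n - of_nat k + (x - s)) * eulerian_sum x s n k"
proof -
  define N where "N = of_nat n + x"
  define p where "p j = pochhammer x j / fact j * (s + of_nat j) ^ n" for j
  have N_Suc: "of_nat (Suc n) + x = N + 1"
    by (simp add: N_def)
  have summand: "(- 1) ^ (Suc k - j) * ((N + 1) gchoose (Suc k - j)) * (p j * (s + of_nat j))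
      = (of_nat (Suc k) + s) * ((- 1) ^ (Suc k - j) * (N gchoose (Suc k - j)) * p j)
        + (of_nat n - of_nat k + (x - s)) * ((- 1) ^ (k - j) * (N gchoose (k - j)) * p j)"
    if "j \<le> k" for j
  proof -
    have "of_nat (Suc (k - j)) + (s + of_nat j) = of_nat (Suc k) + s"
      "N - of_nat (k - j) - (s + of_nat j) = of_nat n - of_nat k + (x - s)"
      using that by (simp_all add: N_def of_nat_diff)
    with gbinomial_eulerian_step [of "k - j" N "s + of_nat j"]
    have "(- 1) ^ (Suc k - j) * ((N + 1) gchoose (Suc k - j)) * (s + of_nat j)
      = (of_nat (Suc k) + s) * ((- 1) ^ (Suc k - j) * (N gchoose (Suc k - j)))
        + (of_nat n - of_nat k + (x - s)) * ((- 1) ^ (k - j) * (N gchoose (k - j)))"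
      using that by (simp only: Suc_diff_le)
    from arg_cong [OF this, of "\<lambda>u. p j * u"] show ?thesis
      by (simp only: distrib_left distrib_right mult_ac)
  qed
  have "eulerian_sum x s (Suc n) (Suc k)
    = (\<Sum>j\<le>k. (- 1) ^ (Suc k - j) * ((N + 1) gchoose (Suc k - j)) * (p j * (s + of_nat j)))
      + (of_nat (Suc k) + s) * p (Suc k)"
    unfolding eulerian_sum_def N_Suc p_def by (simp add: mult_ac add_ac)
  also have "(\<Sum>j\<le>k. (- 1) ^ (Suc k - j) * ((N + 1) gchoose (Suc k - j)) * (p j * (s + of_nat j)))
    = (of_nat (Suc k) + s) * (\<Sum>j\<le>k. (- 1) ^ (Suc k - j) * (N gchoose (Suc k - j)) * p j)
      + (of_nat n - of_nat k + (x - s)) * (\<Sum>j\<le>k. (- 1) ^ (k - j) * (N gchoose (k - j)) * p j)"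
    unfolding sum_distrib_left sum.distrib [symmetric]
    by (intro sum.cong refl summand) simp
  finally show ?thesis
    by (simp add: eulerian_sum_def N_def p_def distrib_left)
qed

lemma st_eulerian_eq_eulerian_sum:
  fixes s t :: "'a::field_char_0"
  shows "st_eulerian s t (int n) (int k) = eulerian_sum (s + t) s n k"
proof (induction n arbitrary: k)
  case 0
  have "st_eulerian s t (- 1) l = 0" for l
    by (simp add: st_eulerian.simps)
  thus ?case
    by (simp add: st_eulerian.simps [of s t 0] eulerian_sum_0)
next
  case (Suc n)
  show ?case
  proof (cases k)
    case 0
    have "st_eulerian s t (int n) (- 1) = 0"
      by (simp add: st_eulerian.simps)
    thus ?thesis
      using Suc.IH [of 0] 0
      by (simp add: st_eulerian.simps [of s t "1 + int n"] eulerian_sum_Suc_0)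
  next
    case (Suc l)
    thus ?thesis
      using Suc.IH [of l] Suc.IH [of "Suc l"]
      by (simp add: st_eulerian.simps [of s t "1 + int n"] eulerian_sum_Suc_Suc)
  qed
qed

theorem theorem13:
  fixes s t :: "'a::field_char_0" and n k :: nat
  assumes "k \<le> n"
  shows "st_eulerian s t (int n) (int k) =
    1 / fact k *
    (\<Sum>j = 0..k. (- 1) ^ (k - j) * of_nat (k choose j)
        * falling_factorial (of_nat n + s + t) (k - j)
        * pochhammer (s + t) j * (s + of_nat j) ^ n)"
proof -
  have "(- 1) ^ (k - j) * ((of_nat n + (s + t)) gchoose (k - j))
        * (pochhammer (s + t) j / fact j * (s + of_nat j) ^ n)
      = 1 / fact k * ((- 1) ^ (k - j) * of_nat (k choose j)
        * falling_factorial (of_nat n + s + t) (k - j)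
        * pochhammer (s + t) j * (s + of_nat j) ^ n)" if "j \<le> k" for j
    using that
    by (simp add: falling_factorial_eq_gbinomial binomial_fact field_simps)
  thus ?thesis
    unfolding st_eulerian_eq_eulerian_sum eulerian_sum_def sum_distrib_left atMost_atLeast0
    by (intro sum.cong) simp_all
qed

end
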